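(* Let $I,J,R$ be positive integers with $R\le\min(I,J)$. Then $\mathcal{P}_R(I,J,2)=\overline{\mathcal{S}}_R(I,J,2)$, i.e. the set of real $I\times J\times 2$ arrays having a full Generalized Schur Decomposition of size $R$ equals the closure in $\mathbb{R}^{I\times J\times 2}$ of the set of real $I\times J\times 2$ arrays of outer-product rank at most $R$.
   Context: All arrays and matrices are real. $\circ$ denotes the outer product of vectors. For $\mathbf{Y}\in\mathbb{R}^{I\times J\times K}$ the outer-product rank is $\mathrm{rank}_\circ(\mathbf{Y})=\min\{R \mid \mathbf{Y}=\sum_{r=1}^R \mathbf{x}_r\circ\mathbf{y}_r\circ\mathbf{z}_r\}$ with $\mathbf{x}_r\in\mathbb{R}^I$, $\mathbf{y}_r\in\mathbb{R}^J$, $\mathbf{z}_r\in\mathbb{R}^K$ (the zero array has rank $0$). Let $\mathcal{S}_R(I,J,K)=\{\mathbf{Y}\in\mathbb{R}^{I\times J\times K}\mid \mathrm{rank}_\circ(\mathbf{Y})\le R\}$, and let $\overline{\mathcal{S}}_R(I,J,K)$ be its closure in $\mathbb{R}^{I\times J\times K}$ with the usual (Frobenius norm) topology. For $\mathbf{Y}\in\mathbb{R}^{I\times J\times 2}$, $\mathbf{Y}_k$ ($k=1,2$) denotes the $k$th frontal slice, the $I\times J$ matrix with entries $y_{ijk}$. For $R\le\min(I,J)$, $\mathcal{P}_R(I,J,2)$ is the set of arrays with a full Generalized Schur Decomposition (GSD): the set of $\mathbf{Y}\in\mathbb{R}^{I\times J\times 2}$ for which there exist matrices $\mathbf{Q}_a\in\mathbb{R}^{I\times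 R}$, $\mathbf{Q}_b\in\mathbb{R}^{J\times R}$ with $\mathbf{Q}_a^T\mathbf{Q}_a=\mathbf{Q}_b^T\mathbf{Q}_b=\mathbf{I}_R$, and upper triangular $\mathbf{R}_1,\mathbf{R}_2\in\mathbb{R}^{R\times R}$ (not necessarily nonsingular), such that $\mathbf{Y}_k=\mathbf{Q}_a\mathbf{R}_k\mathbf{Q}_b^T$ for $k=1,2$. *)

theory Defs
  imports "HOL-Analysis.Analysis"
begin

text \<open>
  A real array of size $I \times J \times K$ is an element of \<open>real ^ 'k ^ 'j ^ 'i\<close>, with entry
  $y_{ijk}$ written \<open>Y $ i $ j $ k\<close>. The norm of this type is the Frobenius norm, so its
  topology is the usual one.
\<close>

definition outer3 :: "real ^ 'i \<Rightarrow> real ^ 'j \<Rightarrow> real ^ 'k \<Rightarrow> real ^ 'k ^ 'j ^ 'i"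
  where "outer3 x y z = (\<chi> i j k. x $ i * y $ j * z $ k)"

definition is_rank1_sum :: "real ^ 'k ^ 'j ^ 'i \<Rightarrow> nat \<Rightarrow> bool"
  where "is_rank1_sum Y R \<longleftrightarrow>
    (\<exists>(x :: nat \<Rightarrow> real ^ 'i) (y :: nat \<Rightarrow> real ^ 'j) (z :: nat \<Rightarrow> real ^ 'k).
       Y = (\<Sum>r = 1..R. outer3 (x r) (y r) (z r)))"

definition outer_rank :: "real ^ 'k ^ 'j ^ 'i \<Rightarrow> nat"
  where "outer_rank Y = (LEAST R. is_rank1_sum Y R)"

text \<open>The \<open>LEAST\<close> above is always attained:\<close>

lemma is_rank1_sum_outer_rank:
  fixes Y :: "real ^ 'k ^ 'j ^ 'i"
  shows "is_rank1_sum Y (outer_rank Y)"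
proof -
  let ?A = "UNIV :: ('i \<times> 'j \<times> 'k) set"
  obtain h where h: "bij_betw h {1..card ?A} ?A"
    using ex_bij_betw_nat_finite_1[of ?A] by auto
  let ?f = "\<lambda>p :: 'i \<times> 'j \<times> 'k. case p of (a, b, c) \<Rightarrow>
    outer3 (Y $ a $ b $ c *\<^sub>R axis a 1 :: real ^ 'i) (axis b 1 :: real ^ 'j) (axis c 1 :: real ^ 'k)"
  have eq: "(\<Sum>p\<in>?A. ?f p) $ i $ j $ k = Y $ i $ j $ k" for i j k
  proof -
    have "(\<Sum>p\<in>?A. ?f p) $ i $ j $ k = (\<Sum>p\<in>?A. if p = (i, j, k) then Y $ i $ j $ k else 0)"
      unfolding sum_component by (intro sum.cong) (auto simp: outer3_def axis_def split: if_splits)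
    then show ?thesis by simp
  qed
  have "Y = (\<Sum>p\<in>?A. ?f p)"
    unfolding vec_eq_iff using eq by simp
  also have "\<dots> = (\<Sum>r = 1..card ?A. ?f (h r))"
    using sum.reindex_bij_betw[OF h, of ?f] by simp
  finally have "is_rank1_sum Y (card ?A)"
    unfolding is_rank1_sum_def
    by (intro exI[of _ "\<lambda>r. Y $ fst (h r) $ fst (snd (h r)) $ snd (snd (h r)) *\<^sub>R axis (fst (h r)) 1"]
        exI[of _ "\<lambda>r. axis (fst (snd (h r))) 1"] exI[of _ "\<lambda>r. axis (snd (snd (h r))) 1"])
      (simp add: case_prod_unfold)
  then show ?thesis
    unfolding outer_rank_def by (rule LeastI)
qed

definition rank_le_arrays :: "nat \<Rightarrow> (real ^ 'k ^ 'j ^ 'i) set"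
  where "rank_le_arrays R = {Y. outer_rank Y \<le> R}"

definition frontal_slice :: "'k \<Rightarrow> real ^ 'k ^ 'j ^ 'i \<Rightarrow> real ^ 'j ^ 'i"
  where "frontal_slice k Y = (\<chi> i j. Y $ i $ j $ k)"

definition upper_triangular :: "real ^ 'r :: {finite, linorder} ^ 'r :: {finite, linorder} \<Rightarrow> bool"
  where "upper_triangular A \<longleftrightarrow> (\<forall>p q. q < p \<longrightarrow> A $ p $ q = 0)"

text \<open>
  The size $R$ of the decomposition is the cardinality of a finite linearly ordered index
  type \<open>'r\<close>, passed as \<open>TYPE('r)\<close>; the order is needed for triangularity.
\<close>

definition full_GSD_arrays :: "'r :: {finite, linorder} itself \<Rightarrow> (real ^ 2 ^ 'j ^ 'i) set"
  where "full_GSD_arrays _ =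
    {Y. \<exists>(Qa :: real ^ 'r :: {finite, linorder} ^ 'i) (Qb :: real ^ 'r :: {finite, linorder} ^ 'j)
          (T :: 2 \<Rightarrow> real ^ 'r :: {finite, linorder} ^ 'r :: {finite, linorder}).
        transpose Qa ** Qa = mat 1 \<and> transpose Qb ** Qb = mat 1 \<and>
        (\<forall>k. upper_triangular (T k) \<and> frontal_slice k Y = Qa ** T k ** transpose Qb)}"

end

theory Submission
  imports Defs
begin

text \<open>
  An array has rank at most \<open>R\<close> exactly when its slices are simultaneously of the form
  \<open>A D\<^sub>k B\<^sup>T\<close> with \<open>D\<^sub>k\<close> diagonal of size \<open>R\<close> (\<open>rank_le_arrays_iff_diag\<close>). Both inclusions
  compare this form with the Schur form \<open>Q\<^sub>a T\<^sub>k Q\<^sub>b\<^sup>T\<close>.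

  From diagonal to triangular: take a QR factorization \<open>A = Q\<^sub>a U\<close> with \<open>U\<close> upper triangular, and,
  running through the columns in the opposite order, a QL factorization \<open>B = Q\<^sub>b L\<close> with \<open>L\<close> lower
  triangular. Then \<open>U D\<^sub>k L\<^sup>T\<close> is upper triangular, so every array of rank at most \<open>R\<close> has a full
  GSD (\<open>rank_le_arrays_subset_full_GSD_arrays\<close>). Matrices with orthonormal columns form a compact
  set, and given \<open>Q\<^sub>a\<close> and \<open>Q\<^sub>b\<close> the triangular factors are forced to be \<open>Q\<^sub>a\<^sup>T Y\<^sub>k Q\<^sub>b\<close>; hence
  the set of arrays with a full GSD is the projection of a closed set along a compact one, and so
  is closed (\<open>closed_full_GSD_arrays\<close>). It therefore contains the closure.

  From triangular to diagonal: if the diagonal of \<open>T\<^sub>1\<close> has no zero and the generalized eigenvalues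
  \<open>(T\<^sub>2)\<^sub>p\<^sub>p / (T\<^sub>1)\<^sub>p\<^sub>p\<close> are distinct, then generalized eigenvectors diagonalize both matrices at
  once (\<open>triangular_pair_diagonalizable\<close>). All eigenvalues lie on the diagonal, hence are real, and
  this generic situation is reached from any triangular pair by an arbitrarily small change of
  the two diagonals (\<open>triangular_pair_perturbation\<close>). So every array with a full GSD is a limit of
  arrays of rank at most \<open>R\<close>.
\<close>

section \<open>Bounded rank as simultaneous diagonal form\<close>

definition diag_mat :: "('n \<Rightarrow> real) \<Rightarrow> real ^ 'n ^ 'n"
  where "diag_mat d = (\<chi> p q. if p = q then d p else 0)"

lemma mult_diag_mat_component:
  fixes A :: "real ^ 'n ^ 'm"
  shows "(A ** diag_mat d) $ i $ q = A $ i $ q * d q"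
  by (simp add: diag_mat_def matrix_matrix_mult_def if_distrib cong: if_cong)

lemma mult_diag_transpose_component:
  fixes A :: "real ^ 'n ^ 'm" and B :: "real ^ 'n ^ 'l"
  shows "(A ** diag_mat d ** transpose B) $ i $ j = (\<Sum>p\<in>UNIV. A $ i $ p * B $ j $ p * d p)"
proof -
  have "(A ** diag_mat d ** transpose B) $ i $ j
      = (\<Sum>p\<in>UNIV. (A ** diag_mat d) $ i $ p * transpose B $ p $ j)"
    by (simp add: matrix_matrix_mult_def)
  then show ?thesis
    by (simp add: mult_diag_mat_component transpose_def mult_ac)
qed

text \<open>
  A sum of fewer terms can be padded with a vanishing one, so being a sum of \<open>n\<close> rank-one terms is
  monotone in \<open>n\<close> and thus equivalent to the minimum being at most \<open>n\<close>.
\<close>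

lemma is_rank1_sum_Suc:
  assumes "is_rank1_sum Y n"
  shows "is_rank1_sum Y (Suc n)"
proof -
  obtain x y z where Y: "Y = (\<Sum>r = 1..n. outer3 (x r) (y r) (z r))"
    using assms unfolding is_rank1_sum_def by blast
  have "(\<Sum>r = 1..n. outer3 ((x(Suc n := 0)) r) (y r) (z r)) = Y"
    unfolding Y by (intro sum.cong) auto
  moreover have "outer3 0 (y (Suc n)) (z (Suc n)) = 0"
    by (simp add: outer3_def vec_eq_iff)
  ultimately have "Y = (\<Sum>r = 1..Suc n. outer3 ((x(Suc n := 0)) r) (y r) (z r))"
    by simp
  then show ?thesis
    unfolding is_rank1_sum_def by blast
qed

lemma rank_le_arrays_iff: "Y \<in> rank_le_arrays n \<longleftrightarrow> is_rank1_sum Y n"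
proof
  assume "Y \<in> rank_le_arrays n"
  then have "outer_rank Y \<le> n"
    by (simp add: rank_le_arrays_def)
  then show "is_rank1_sum Y n"
    by (induction rule: dec_induct) (auto intro: is_rank1_sum_outer_rank is_rank1_sum_Suc)
next
  assume "is_rank1_sum Y n"
  then show "Y \<in> rank_le_arrays n"
    by (simp add: rank_le_arrays_def outer_rank_def Least_le)
qed

text \<open>
  The columns of \<open>A\<close> and \<open>B\<close> are the first two vectors of the rank-one terms; the \<open>k\<close>-th entries
  of the third vectors form the diagonal of the \<open>k\<close>-th slice. Indexing the terms by a type
  \<open>'r\<close> instead of \<open>{1..R}\<close> turns this into a statement about matrix products.
\<close>

lemma rank_le_arrays_iff_diag:
  fixes Y :: "real ^ 'k ^ 'j ^ 'i"
  shows "Y \<in> rank_le_arrays CARD('r::finite) \<longleftrightarrow>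
    (\<exists>(A :: real ^ 'r ^ 'i) (B :: real ^ 'r ^ 'j) d.
      \<forall>k. frontal_slice k Y = A ** diag_mat (d k) ** transpose B)"
    (is "_ \<longleftrightarrow> ?R")
proof -
  obtain h where h: "bij_betw h {1..CARD('r)} (UNIV :: 'r set)"
    using ex_bij_betw_nat_finite_1[of "UNIV :: 'r set"] by auto
  define g where "g = inv_into {1..CARD('r)} h"
  have g: "g (h r) = r" if "r \<in> {1..CARD('r)}" for r
    using h that by (simp add: g_def bij_betw_inv_into_left)
  have comp: "(\<Sum>r = 1..CARD('r). outer3 (x r) (y r) (z r)) $ i $ j $ k
      = (\<Sum>p\<in>UNIV. x (g p) $ i * y (g p) $ j * z (g p) $ k)"
    for x y z and i :: 'i and j :: 'j and k :: 'k
    unfolding sum.reindex_bij_betw[OF h, symmetric]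
    by (simp add: sum_component outer3_def g)
  show ?thesis
  proof
    assume "Y \<in> rank_le_arrays CARD('r)"
    then obtain x y z where Y: "Y = (\<Sum>r = 1..CARD('r). outer3 (x r) (y r) (z r))"
      by (auto simp: rank_le_arrays_iff is_rank1_sum_def)
    have "Y $ i $ j $ k = (\<Sum>p\<in>UNIV. x (g p) $ i * y (g p) $ j * z (g p) $ k)" for i j k
      unfolding Y by (rule comp)
    then show ?R
      by (intro exI[of _ "\<chi> i p. x (g p) $ i"] exI[of _ "\<chi> j p. y (g p) $ j"]
          exI[of _ "\<lambda>k p. z (g p) $ k"])
        (simp add: vec_eq_iff mult_diag_transpose_component frontal_slice_def)
  next
    assume ?R
    then obtain A :: "real ^ 'r ^ 'i" and B :: "real ^ 'r ^ 'j" and d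
      where AB: "\<And>k. frontal_slice k Y = A ** diag_mat (d k) ** transpose B"
      by blast
    have "Y $ i $ j $ k = (\<Sum>p\<in>UNIV. A $ i $ p * B $ j $ p * d k p)" for i j k
      using AB[of k] by (simp add: vec_eq_iff mult_diag_transpose_component frontal_slice_def)
    moreover have "(\<Sum>p\<in>UNIV. F p) = (\<Sum>r=1..CARD('r). F (h r))" for F :: "'r \<Rightarrow> real"
      using sum.reindex_bij_betw[OF h, of F] by simp
    ultimately have "Y = (\<Sum>r = 1..CARD('r). outer3 (column (h r) A) (column (h r) B) (\<chi> k. d k (h r)))"
      by (simp add: vec_eq_iff sum_component outer3_def column_def)
    then show "Y \<in> rank_le_arrays CARD('r)"
      unfolding rank_le_arrays_iff is_rank1_sum_def
      by (intro exI[of _ "\<lambda>r. column (h r) A"] exI[of _ "\<lambda>r. column (h r) B"]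
          exI[of _ "\<lambda>r. \<chi> k. d k (h r)"])
  qed
qed

section \<open>Arrays of bounded rank have a full GSD\<close>

lemma upper_triangular_mult:
  assumes "upper_triangular A" "upper_triangular B"
  shows "upper_triangular (A ** B)"
proof -
  have "A $ p $ s * B $ s $ q = 0" if "q < p" for p q s
    using assms that unfolding upper_triangular_def
    by (metis less_le_trans mult_eq_0_iff not_le)
  then have "(\<Sum>s\<in>UNIV. A $ p $ s * B $ s $ q) = 0" if "q < p" for p q
    using that by (intro sum.neutral) blast
  then show ?thesis
    by (simp add: upper_triangular_def matrix_matrix_mult_def)
qed

lemma upper_triangular_diag_mat: "upper_triangular (diag_mat d)"
  by (auto simp: upper_triangular_def diag_mat_def)

text \<open>
  One step of Gram-Schmidt that also succeeds when \<open>a\<close> already lies in the span of \<open>S\<close>: then any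
  unit vector orthogonal to \<open>S\<close> will do, and the dimension bound supplies one.
\<close>

lemma exists_unit_orthogonal_extension:
  fixes S :: "'a::euclidean_space set"
  assumes "dim S < DIM('a)"
  obtains u where "norm u = 1" "\<And>x. x \<in> span S \<Longrightarrow> orthogonal u x" "a \<in> span (insert u S)"
proof -
  obtain y z where yz: "y \<in> span S" "\<And>w. w \<in> span S \<Longrightarrow> orthogonal z w" "a = y + z"
    using orthogonal_subspace_decomp_exists[of S a] by metis
  obtain v where v: "v \<noteq> 0" "\<And>x. x \<in> span S \<Longrightarrow> orthogonal v x" "a \<in> span (insert v S)"
  proof (cases "z = 0")
    case True
    obtain v where "v \<noteq> 0" "\<And>x. x \<in> span S \<Longrightarrow> orthogonal v x"
      using orthogonal_to_subspace_exists[OF assms] by blast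
    moreover have "a \<in> span (insert v S)"
      using yz True span_mono[of S "insert v S"] by auto
    ultimately show ?thesis using that by blast
  next
    case False
    moreover have "a \<in> span (insert z S)"
      using yz span_mono[of S "insert z S"] by (auto intro!: span_add intro: span_base)
    ultimately show ?thesis using that yz(2) by blast
  qed
  show ?thesis
  proof
    show "norm (v /\<^sub>R norm v) = 1" using v by simp
    show "orthogonal (v /\<^sub>R norm v) x" if "x \<in> span S" for x
      using v(2)[OF that] by (simp add: orthogonal_def)
    have "v = norm v *\<^sub>R (v /\<^sub>R norm v)" using v by simp
    then have "v \<in> span (insert (v /\<^sub>R norm v) S)"
      by (metis insertI1 span_base span_scale)
    then have "insert v S \<subseteq> span (insert (v /\<^sub>R norm v) S)"
      by (auto intro: span_base)
    then show "a \<in> span (insert (v /\<^sub>R norm v) S)"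
      using v(3) span_minimal by blast
  qed
qed

text \<open>
  Gram-Schmidt for a possibly dependent family. The order of processing is given by a ranking
  \<open>f\<close> so that the same result serves for the increasing and the decreasing order of an index set.
\<close>

lemma exists_orthonormal_flag:
  fixes a :: "'r \<Rightarrow> 'a::euclidean_space" and f :: "'r \<Rightarrow> 'o::linorder"
  assumes "finite S" "inj_on f S" "card S \<le> DIM('a)"
  shows "\<exists>q. (\<forall>s\<in>S. \<forall>t\<in>S. q s \<bullet> q t = (if s = t then 1 else 0)) \<and>
    (\<forall>p\<in>S. a p \<in> span (q ` {s\<in>S. f s \<le> f p}))"
  using assms
proof (induction S rule: finite_ranking_induct[where f = f])
  case empty
  then show ?case by simp
next
  case (insert b S)
  show ?case
  proof (cases "b \<in> S")
    case True
    then show ?thesis using insert by (simp add: insert_absorb)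
  next
    case False
    obtain q where q: "\<forall>s\<in>S. \<forall>t\<in>S. q s \<bullet> q t = (if s = t then 1 else 0)"
        "\<forall>p\<in>S. a p \<in> span (q ` {s\<in>S. f s \<le> f p})"
      using insert False by auto
    have "dim (q ` S) \<le> card S"
      using insert(1) by (meson card_image_le dim_le_card' finite_imageI le_trans)
    also have "\<dots> < DIM('a)"
      using insert False by simp
    finally obtain u where u: "norm u = 1" "\<And>x. x \<in> span (q ` S) \<Longrightarrow> orthogonal u x"
        "a b \<in> span (insert u (q ` S))"
      using exists_unit_orthogonal_extension by metis
    define q' where "q' = q(b := u)"
    have uq: "u \<bullet> q s = 0" "q s \<bullet> u = 0" if "s \<in> S" for s
      using u(2)[of "q s"] that by (auto simp: orthogonal_def span_base inner_commute)
    have "\<forall>s\<in>insert b S. \<forall>t\<in>insert b S. q' s \<bullet> q' t = (if s = t then 1 else 0)"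
      using q(1) uq u(1) False by (auto simp: q'_def norm_eq_1)
    moreover have "a p \<in> span (q' ` {s\<in>insert b S. f s \<le> f p})" if "p \<in> insert b S" for p
    proof (cases "p = b")
      case True
      have "q' ` {s\<in>insert b S. f s \<le> f b} = insert u (q ` S)"
        using insert(2) False by (auto simp: q'_def image_iff)
      then show ?thesis using u(3) True by simp
    next
      case pS: False
      have "q ` {s\<in>S. f s \<le> f p} \<subseteq> q' ` {s\<in>insert b S. f s \<le> f p}"
        using False by (auto simp: q'_def image_iff)
      then show ?thesis using q(2) pS that span_mono by blast
    qed
    ultimately show ?thesis by blast
  qed
qed

text \<open>
  The matrix form of the flag: \<open>Q\<^sup>T A\<close> is triangular with respect to the ranking \<open>f\<close>, since the
  column \<open>p\<close> of \<open>A\<close> is a combination of the columns of \<open>Q\<close> ranked at most \<open>f p\<close>, and all later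
  ones are orthogonal to it. An increasing \<open>f\<close> gives QR, a decreasing one gives QL.
\<close>

lemma exists_orthonormal_factor:
  fixes A :: "real ^ 'r ^ 'i" and f :: "'r \<Rightarrow> 'o::linorder"
  assumes "inj f" "CARD('r) \<le> CARD('i)"
  obtains Q :: "real ^ 'r ^ 'i" where "transpose Q ** Q = mat 1" "Q ** (transpose Q ** A) = A"
    "\<And>s p. f p < f s \<Longrightarrow> (transpose Q ** A) $ s $ p = 0"
proof -
  obtain q :: "'r \<Rightarrow> real ^ 'i" where q: "\<And>s t. q s \<bullet> q t = (if s = t then 1 else 0)"
      "\<And>p. column p A \<in> span (q ` {s. f s \<le> f p})"
    using exists_orthonormal_flag[of "UNIV :: 'r set" f "\<lambda>p. column p A"] assms by auto
  define Q :: "real ^ 'r ^ 'i" where "Q = (\<chi> i s. q s $ i)"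
  have QA: "(transpose Q ** A) $ s $ p = q s \<bullet> column p A" for s p
    by (simp add: Q_def transpose_def matrix_matrix_mult_def inner_vec_def column_def)
  show ?thesis
  proof
    show "transpose Q ** Q = mat 1"
      using q(1) by (simp add: vec_eq_iff Q_def transpose_def matrix_matrix_mult_def inner_vec_def mat_def)
    show "(transpose Q ** A) $ s $ p = 0" if "f p < f s" for s p
    proof -
      have "orthogonal (q s) (column p A)"
        using that by (intro orthogonal_to_span[OF q(2)]) (auto simp: orthogonal_def q(1))
      then show ?thesis by (simp add: QA orthogonal_def)
    qed
    \<comment> \<open>The columns of Q form an orthonormal basis of their span, so Q Q^T fixes that span.\<close>
    have *: "x = (\<Sum>s\<in>UNIV. (q s \<bullet> x) *\<^sub>R q s)" if "x \<in> span (range q)" for x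
      using that
    proof (induction rule: span_induct_alt)
      case base
      then show ?case by simp
    next
      case (step c x y)
      then obtain t where t: "x = q t" by auto
      have "(\<Sum>s\<in>UNIV. (q s \<bullet> (c *\<^sub>R q t + y)) *\<^sub>R q s)
          = (\<Sum>s\<in>UNIV. (if s = t then c *\<^sub>R q t else 0)) + (\<Sum>s\<in>UNIV. (q s \<bullet> y) *\<^sub>R q s)"
        unfolding sum.distrib[symmetric]
        by (intro sum.cong) (auto simp: inner_add_right q(1) scaleR_add_left)
      then show ?case
        using t by (simp flip: step(2))
    qed
    have "column p A = (\<Sum>s\<in>UNIV. (q s \<bullet> column p A) *\<^sub>R q s)" for p
      by (rule *, rule subsetD[OF span_mono q(2)]) blast
    then have expand: "column p A $ i = (\<Sum>s\<in>UNIV. (q s \<bullet> column p A) *\<^sub>R q s) $ i" for i p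
      by (rule arg_cong)
    have "(Q ** (\<chi> s p. q s \<bullet> column p A)) $ i $ p = A $ i $ p" for i p
    proof -
      have "(Q ** (\<chi> s p. q s \<bullet> column p A)) $ i $ p
          = (\<Sum>s\<in>UNIV. (q s \<bullet> column p A) *\<^sub>R q s) $ i"
        by (simp add: matrix_matrix_mult_def Q_def mult.commute)
      also have "\<dots> = column p A $ i"
        by (rule expand[symmetric])
      finally show ?thesis by (simp add: column_def)
    qed
    then have "Q ** (\<chi> s p. q s \<bullet> column p A) = A"
      by (simp add: vec_eq_iff)
    moreover have "(\<chi> s p. q s \<bullet> column p A) = transpose Q ** A"
      using QA by (simp add: vec_eq_iff)
    ultimately show "Q ** (transpose Q ** A) = A" by simp
  qed
qed

lemma exists_strict_mono_real:
  obtains c :: "'r::{finite,linorder} \<Rightarrow> real" where "strict_mono c"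
proof
  show "strict_mono (\<lambda>p :: 'r. real (card {q. q < p}))"
    by (intro strict_monoI) (auto intro!: psubset_card_mono)
qed

text \<open>
  QR for the first factor and QL for the second make \<open>U\<close> and \<open>L\<^sup>T\<close> upper triangular for the same
  order, hence also the middle factors \<open>U D\<^sub>k L\<^sup>T\<close>.
\<close>

lemma rank_le_arrays_subset_full_GSD_arrays:
  assumes "CARD('r :: {finite, linorder}) \<le> min CARD('i :: finite) CARD('j :: finite)"
  shows "(rank_le_arrays CARD('r) :: (real ^ 2 ^ 'j ^ 'i) set) \<subseteq> full_GSD_arrays TYPE('r)"
proof
  fix Y :: "real ^ 2 ^ 'j ^ 'i"
  assume "Y \<in> rank_le_arrays CARD('r)"
  then obtain A :: "real ^ 'r::_ ^ 'i" and B :: "real ^ 'r::_ ^ 'j" and d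
    where Y: "\<And>k. frontal_slice k Y = A ** diag_mat (d k) ** transpose B"
    by (auto simp: rank_le_arrays_iff_diag)
  obtain c :: "'r \<Rightarrow> real" where c: "strict_mono c"
    using exists_strict_mono_real .
  then have inj: "inj c" "inj (\<lambda>p. - c p)"
    by (auto simp: strict_mono_eq inj_def)
  obtain Qa :: "real ^ 'r::_ ^ 'i" where Qa: "transpose Qa ** Qa = mat 1"
      "Qa ** (transpose Qa ** A) = A" "\<And>s p. c p < c s \<Longrightarrow> (transpose Qa ** A) $ s $ p = 0"
    using exists_orthonormal_factor[OF inj(1), of A] assms by auto
  obtain Qb :: "real ^ 'r::_ ^ 'j" where Qb: "transpose Qb ** Qb = mat 1"
      "Qb ** (transpose Qb ** B) = B" "\<And>s p. - c p < - c s \<Longrightarrow> (transpose Qb ** B) $ s $ p = 0"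
    using exists_orthonormal_factor[OF inj(2), of B] assms by auto
  define U where "U = transpose Qa ** A"
  define L where "L = transpose Qb ** B"
  have "upper_triangular U" "upper_triangular (transpose L)"
    using Qa(3) Qb(3) c by (auto simp: upper_triangular_def transpose_def U_def L_def strict_mono_less)
  then have tri: "upper_triangular (U ** diag_mat (d k) ** transpose L)" for k
    by (intro upper_triangular_mult upper_triangular_diag_mat)
  have "frontal_slice k Y = Qa ** (U ** diag_mat (d k) ** transpose L) ** transpose Qb" for k
  proof -
    have "frontal_slice k Y = (Qa ** U) ** diag_mat (d k) ** transpose (Qb ** L)"
      using Y Qa(2) Qb(2) by (simp add: U_def L_def)
    then show ?thesis by (simp add: matrix_transpose_mul matrix_mul_assoc)
  qed
  with tri Qa(1) Qb(1) show "Y \<in> full_GSD_arrays TYPE('r)"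
    unfolding full_GSD_arrays_def
    by (intro CollectI exI[of _ Qa] exI[of _ Qb] exI[of _ "\<lambda>k. U ** diag_mat (d k) ** transpose L"]) auto
qed

section \<open>Simultaneous diagonalization of triangular pairs\<close>

text \<open>
  In the row of the last nonzero entry of a kernel vector only the diagonal term survives. This
  shows both that a nonzero diagonal forces injectivity and where kernel vectors can end.
\<close>

lemma upper_triangular_kernel_pivot:
  assumes "upper_triangular N" "N *v x = 0" "x \<noteq> 0"
  obtains q where "x $ q \<noteq> 0" "\<And>s. q < s \<Longrightarrow> x $ s = 0" "N $ q $ q = 0"
proof -
  have fin: "finite {q. x $ q \<noteq> 0}" "{q. x $ q \<noteq> 0} \<noteq> {}"
    using assms(3) by (auto simp: vec_eq_iff)
  define q where "q = Max {q. x $ q \<noteq> 0}"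
  have q: "x $ q \<noteq> 0"
    using Max_in[OF fin] by (simp add: q_def)
  have "s \<le> q" if "x $ s \<noteq> 0" for s
    unfolding q_def using that by (intro Max_ge[OF fin(1)]) simp
  then have above: "x $ s = 0" if "q < s" for s
    using that by (meson not_le)
  have "N $ q $ s * x $ s = (if s = q then N $ q $ q * x $ q else 0)" for s
    using assms(1) above[of s] by (cases s q rule: linorder_cases) (auto simp: upper_triangular_def)
  then have "(N *v x) $ q = (\<Sum>s\<in>UNIV. if s = q then N $ q $ q * x $ q else 0)"
    unfolding matrix_vector_mult_def vec_lambda_beta by (intro sum.cong refl)
  then have "N $ q $ q = 0"
    using assms(2) q by simp
  then show ?thesis using that q above by blast
qed

text \<open>
  With a zero at position \<open>p\<close> of the diagonal, \<open>N\<close> maps the span of the basis vectors up to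
  \<open>p\<close> into the span of those strictly before \<open>p\<close>, which has smaller dimension.
\<close>

lemma upper_triangular_kernel_exists:
  fixes N :: "real ^ 'r::{finite,linorder} ^ 'r::{finite,linorder}"
  assumes "upper_triangular N" "N $ p $ p = 0"
  obtains x where "x \<noteq> 0" "N *v x = 0" "\<And>q. p < q \<Longrightarrow> x $ q = 0"
proof -
  define V where "V = {x :: real ^ 'r::_. \<forall>q. q \<notin> {..p} \<longrightarrow> x $ q = 0}"
  define W where "W = {x :: real ^ 'r::_. \<forall>q. q \<notin> {..<p} \<longrightarrow> x $ q = 0}"
  have dims: "dim V = card {..p}" "dim W = card {..<p}"
    unfolding V_def W_def by (simp_all only: dim_substandard_cart flip: dim_vec_eq)
  have sub: "subspace V"
    by (auto simp: V_def subspace_def)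
  have "N *v x \<in> W" if "x \<in> V" for x
  proof -
    have "N $ q $ s * x $ s = 0" if "q \<ge> p" for q s
      using assms that \<open>x \<in> V\<close>
      by (cases s q rule: linorder_cases; cases s p rule: linorder_cases)
        (auto simp: V_def upper_triangular_def)
    then have "(N *v x) $ q = 0" if "q \<ge> p" for q
      unfolding matrix_vector_mult_def using that by (simp add: sum.neutral del: mult_eq_0_iff)
    then show ?thesis
      by (simp add: W_def)
  qed
  then have "(\<lambda>x. N *v x) ` V \<subseteq> W" by blast
  then have "dim ((\<lambda>x. N *v x) ` V) \<le> dim W"
    by (rule dim_subset)
  also have "\<dots> < dim V"
    unfolding dims by (intro psubset_card_mono) auto
  finally have "\<not> inj_on (\<lambda>x. N *v x) (span V)"
    using dim_image_eq[of "(*v) N" V] by auto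
  then have "\<not> inj_on (\<lambda>x. N *v x) V"
    by (simp add: span_eq_iff[THEN iffD2, OF sub])
  then obtain x y where "x \<in> V" "y \<in> V" "x \<noteq> y" "N *v x = N *v y"
    by (auto simp: inj_on_def)
  then have "x - y \<noteq> 0" "N *v (x - y) = 0" "\<And>q. p < q \<Longrightarrow> (x - y) $ q = 0"
    by (auto simp: matrix_vector_mult_diff_distrib V_def)
  then show ?thesis using that by blast
qed

text \<open>
  For each \<open>p\<close> the matrix \<open>T2 - d p T1\<close> is triangular with its only diagonal zero at \<open>p\<close>, so it
  has a kernel vector whose last nonzero entry is at \<open>p\<close>. These vectors are the columns of an
  upper triangular matrix \<open>X\<close> with nonzero diagonal; being invertible, it gives
  \<open>T1 = (T1 X) X\<^sup>-\<^sup>1\<close> and \<open>T2 = (T1 X) D X\<^sup>-\<^sup>1\<close>.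
\<close>

lemma triangular_pair_diagonalizable:
  fixes T1 T2 :: "real ^ 'r::{finite,linorder} ^ 'r::{finite,linorder}"
  assumes tri: "upper_triangular T1" "upper_triangular T2"
    and nz: "\<And>p. T1 $ p $ p \<noteq> 0"
    and dist: "\<And>p q. p \<noteq> q \<Longrightarrow> T2 $ p $ p * T1 $ q $ q \<noteq> T2 $ q $ q * T1 $ p $ p"
  obtains A B :: "real ^ 'r::{finite,linorder} ^ 'r::{finite,linorder}" and d
    where "T1 = A ** transpose B" "T2 = A ** diag_mat d ** transpose B"
proof -
  define d where "d p = T2 $ p $ p / T1 $ p $ p" for p
  have "\<exists>x. T2 *v x = d p *\<^sub>R (T1 *v x) \<and> x $ p \<noteq> 0 \<and> (\<forall>q>p. x $ q = 0)" for p
  proof -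
    define N where "N = T2 - d p *\<^sub>R T1"
    have N: "upper_triangular N" "N $ p $ p = 0"
      using tri nz by (auto simp: N_def upper_triangular_def d_def)
    have Nq: "N $ q $ q \<noteq> 0" if "q \<noteq> p" for q
      using dist[OF that] nz[of p] by (simp add: N_def d_def field_simps)
    obtain x where x: "x \<noteq> 0" "N *v x = 0" "\<And>q. p < q \<Longrightarrow> x $ q = 0"
      using upper_triangular_kernel_exists[OF N] by blast
    obtain q where "x $ q \<noteq> 0" "N $ q $ q = 0"
      using upper_triangular_kernel_pivot[OF N(1) x(2,1)] by blast
    then have "x $ p \<noteq> 0" using Nq by metis
    moreover have "T2 *v x = d p *\<^sub>R (T1 *v x)"
      using x(2) by (simp add: N_def matrix_vector_mult_diff_rdistrib scaleR_matrix_vector_assoc)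
    ultimately show ?thesis using x(3) by blast
  qed
  then obtain x where x: "\<And>p. T2 *v x p = d p *\<^sub>R (T1 *v x p)" "\<And>p. x p $ p \<noteq> 0"
      "\<And>p q. p < q \<Longrightarrow> x p $ q = 0"
    by metis
  define X where "X = (\<chi> q p. x p $ q)"
  have X: "upper_triangular X" "\<And>p. X $ p $ p \<noteq> 0"
    using x by (auto simp: X_def upper_triangular_def)
  have "\<forall>v. X *v v = 0 \<longrightarrow> v = 0"
    using upper_triangular_kernel_pivot[OF X(1)] X(2) by metis
  then obtain Z where "Z ** X = mat 1"
    using matrix_left_invertible_ker by blast
  then have Z: "X ** Z = mat 1"
    by (simp add: matrix_left_right_inverse)
  have col: "(T ** X) $ i $ p = (T *v x p) $ i" for T :: "real ^ 'r::_ ^ 'r::_" and i p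
    by (simp add: X_def matrix_matrix_mult_def matrix_vector_mult_def)
  have "T2 ** X = T1 ** X ** diag_mat d"
    unfolding vec_eq_iff mult_diag_mat_component col using x(1) by simp
  then have "T2 = T1 ** X ** diag_mat d ** transpose (transpose Z)"
    by (metis Z matrix_mul_assoc matrix_mul_rid transpose_transpose)
  moreover have "T1 = T1 ** X ** transpose (transpose Z)"
    by (metis Z matrix_mul_assoc matrix_mul_rid transpose_transpose)
  ultimately show ?thesis using that by blast
qed

section \<open>Perturbation to distinct generalized eigenvalues\<close>

lemma eventually_poly_nonzero:
  fixes f :: "real poly"
  assumes "f \<noteq> 0"
  shows "eventually (\<lambda>s. poly f s \<noteq> 0) (at a)"
proof -
  have "\<not> a islimpt {s. poly f s = 0}"
    using poly_roots_finite[OF assms] by (rule islimpt_finite)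
  then show ?thesis
    by (simp add: islimpt_iff_eventually)
qed

text \<open>
  Each condition says that a polynomial in \<open>s\<close> does not vanish, and each of these polynomials is
  nonzero: the first are monic of degree one, and the cross products have leading coefficient
  \<open>c p - c q\<close> in degree two. Only finitely many \<open>s\<close> are excluded.
\<close>

lemma triangular_pair_perturbation:
  fixes T1 T2 :: "real ^ 'r ^ 'r" and c :: "'r \<Rightarrow> real"
  assumes "inj c"
  shows "eventually (\<lambda>s. (\<forall>p. (T1 + s *\<^sub>R mat 1) $ p $ p \<noteq> 0) \<and>
    (\<forall>p q. p \<noteq> q \<longrightarrow> (T2 + s *\<^sub>R diag_mat c) $ p $ p * (T1 + s *\<^sub>R mat 1) $ q $ q \<noteq>
      (T2 + s *\<^sub>R diag_mat c) $ q $ q * (T1 + s *\<^sub>R mat 1) $ p $ p)) (at 0)"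
proof -
  have "eventually (\<lambda>s. (T1 + s *\<^sub>R mat 1) $ p $ p \<noteq> 0) (at 0)" for p
    using eventually_poly_nonzero[of "[:T1 $ p $ p, 1:]" 0] by (simp add: mat_def)
  moreover have "eventually (\<lambda>s. p \<noteq> q \<longrightarrow>
      (T2 + s *\<^sub>R diag_mat c) $ p $ p * (T1 + s *\<^sub>R mat 1) $ q $ q \<noteq>
      (T2 + s *\<^sub>R diag_mat c) $ q $ q * (T1 + s *\<^sub>R mat 1) $ p $ p) (at 0)" for p q
  proof (cases "p = q")
    case False
    let ?f = "[:T2 $ p $ p, c p:] * [:T1 $ q $ q, 1:] - [:T2 $ q $ q, c q:] * [:T1 $ p $ p, 1:]"
    have "coeff ?f 2 = c p - c q"
      by (simp add: numeral_2_eq_2)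
    also have "\<dots> \<noteq> 0"
      using assms False by (auto simp: inj_def)
    finally have "?f \<noteq> 0"
      by (metis coeff_0)
    from eventually_poly_nonzero[OF this, of 0] show ?thesis
      by eventually_elim (simp add: mat_def diag_mat_def algebra_simps)
  qed simp
  ultimately show ?thesis
    by (simp add: eventually_conj_iff eventually_all_finite)
qed

text \<open>
  The perturbation acts on the triangular factors only, so it moves the array along a line
  \<open>Y + s E\<close>, whose points near \<open>s = 0\<close> have rank at most \<open>R\<close>.
\<close>

lemma full_GSD_arrays_subset_closure:
  "(full_GSD_arrays TYPE('r :: {finite, linorder}) :: (real ^ 2 ^ 'j ^ 'i) set)
    \<subseteq> closure (rank_le_arrays CARD('r))"
proof
  fix Y :: "real ^ 2 ^ 'j ^ 'i"
  assume "Y \<in> full_GSD_arrays TYPE('r)"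
  then obtain Qa :: "real ^ 'r::_ ^ 'i" and Qb :: "real ^ 'r::_ ^ 'j" and T :: "2 \<Rightarrow> real ^ 'r::_ ^ 'r::_"
    where T: "\<And>k. upper_triangular (T k)" and Y: "\<And>k. frontal_slice k Y = Qa ** T k ** transpose Qb"
    by (auto simp: full_GSD_arrays_def)
  obtain c :: "'r \<Rightarrow> real" where c: "strict_mono c"
    using exists_strict_mono_real .
  define G :: "2 \<Rightarrow> real ^ 'r::_ ^ 'r::_" where "G k = (if k = 1 then mat 1 else diag_mat c)" for k
  define E :: "real ^ 2 ^ 'j ^ 'i" where "E = (\<chi> i j k. (Qa ** G k ** transpose Qb) $ i $ j)"
  have G: "upper_triangular (G k)" for k
    by (auto simp: G_def upper_triangular_diag_mat) (auto simp: upper_triangular_def mat_def)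
  have tri: "upper_triangular (T k + s *\<^sub>R G k)" for s k
    using T[of k] G[of k] by (simp add: upper_triangular_def)
  have slice: "frontal_slice k (Y + s *\<^sub>R E) = Qa ** (T k + s *\<^sub>R G k) ** transpose Qb" for s k
  proof -
    have "frontal_slice k (Y + s *\<^sub>R E) = frontal_slice k Y + s *\<^sub>R (Qa ** G k ** transpose Qb)"
      by (simp add: frontal_slice_def E_def vec_eq_iff)
    then show ?thesis
      unfolding Y
      by (simp add: vec_eq_iff matrix_matrix_mult_def sum.distrib sum_distrib_left algebra_simps)
  qed
  have "inj c"
    using c by (simp add: strict_mono_imp_inj_on)
  from triangular_pair_perturbation[OF this, of "T 1" "T 2"]
  have "eventually (\<lambda>s. Y + s *\<^sub>R E \<in> rank_le_arrays CARD('r)) (at 0)"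
  proof eventually_elim
    case (elim s)
    have "T 1 + s *\<^sub>R mat 1 = T 1 + s *\<^sub>R G 1" "T 2 + s *\<^sub>R diag_mat c = T 2 + s *\<^sub>R G 2"
      by (simp_all add: G_def)
    with elim obtain A B :: "real ^ 'r::_ ^ 'r::_" and d
      where AB: "T 1 + s *\<^sub>R G 1 = A ** transpose B" "T 2 + s *\<^sub>R G 2 = A ** diag_mat d ** transpose B"
      using triangular_pair_diagonalizable[OF tri tri, of 1 s 2 s] by metis
    define D :: "2 \<Rightarrow> 'r \<Rightarrow> real" where "D k = (if k = 1 then (\<lambda>_. 1) else d)" for k
    have "diag_mat (\<lambda>_. 1) = (mat 1 :: real ^ 'r::_ ^ 'r::_)"
      by (simp add: diag_mat_def mat_def)
    then have "T k + s *\<^sub>R G k = A ** diag_mat (D k) ** transpose B" for k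
      using AB exhaust_2[of k] by (auto simp: D_def)
    then have "frontal_slice k (Y + s *\<^sub>R E) = (Qa ** A) ** diag_mat (D k) ** transpose (Qb ** B)" for k
      unfolding slice by (simp add: matrix_transpose_mul matrix_mul_assoc)
    then show ?case
      unfolding rank_le_arrays_iff_diag by blast
  qed
  then have "eventually (\<lambda>s. Y + s *\<^sub>R E \<in> closure (rank_le_arrays CARD('r))) (at 0)"
    by eventually_elim (rule subsetD[OF closure_subset])
  moreover have "((\<lambda>s. Y + s *\<^sub>R E) \<longlongrightarrow> Y + 0 *\<^sub>R E) (at 0)"
    by (intro tendsto_intros)
  ultimately have "Y + 0 *\<^sub>R E \<in> closure (rank_le_arrays CARD('r))"
    by (intro Lim_in_closed_set[OF closed_closure]) auto
  then show "Y \<in> closure (rank_le_arrays CARD('r))" by simp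
qed

section \<open>The set of arrays with a full GSD is closed\<close>

lemma continuous_on_matrix_mult [continuous_intros]:
  fixes f :: "'a::topological_space \<Rightarrow> real ^ 'm ^ 'n" and g :: "'a \<Rightarrow> real ^ 'l ^ 'm"
  assumes "continuous_on S f" "continuous_on S g"
  shows "continuous_on S (\<lambda>x. f x ** g x)"
  unfolding matrix_matrix_mult_def
  by (intro continuous_on_vec_lambda continuous_intros assms)

lemma continuous_on_transpose [continuous_intros]:
  fixes f :: "'a::topological_space \<Rightarrow> real ^ 'm ^ 'n"
  assumes "continuous_on S f"
  shows "continuous_on S (\<lambda>x. transpose (f x))"
  unfolding transpose_def
  by (intro continuous_on_vec_lambda continuous_intros assms)

lemma continuous_on_frontal_slice [continuous_intros]:
  fixes f :: "'a::topological_space \<Rightarrow> real ^ 'k ^ 'j ^ 'i"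
  assumes "continuous_on S f"
  shows "continuous_on S (\<lambda>x. frontal_slice k (f x))"
  unfolding frontal_slice_def
  by (intro continuous_on_vec_lambda continuous_intros assms)

lemma compact_orthonormal_columns:
  "compact {Q :: real ^ 'r ^ 'i. transpose Q ** Q = mat 1}"
  unfolding compact_eq_bounded_closed
proof
  have "norm Q \<le> (\<Sum>i\<in>(UNIV :: 'i set). \<Sum>r\<in>(UNIV :: 'r set). 1)"
    if "transpose Q ** Q = mat 1" for Q :: "real ^ 'r ^ 'i"
  proof -
    have "\<bar>Q $ i $ r\<bar> \<le> 1" for i r
    proof -
      have "(\<Sum>i\<in>UNIV. Q $ i $ r * Q $ i $ r) = (transpose Q ** Q) $ r $ r"
        by (simp add: matrix_matrix_mult_def transpose_def)
      also have "\<dots> = 1"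
        using that by (simp add: mat_def)
      finally have "Q $ i $ r * Q $ i $ r \<le> 1"
        using member_le_sum[of i UNIV "\<lambda>i. Q $ i $ r * Q $ i $ r"] by simp
      then show ?thesis
        by (simp add: abs_square_le_1 flip: power2_eq_square)
    qed
    then have "norm (Q $ i) \<le> (\<Sum>r\<in>(UNIV :: 'r set). 1)" for i
      by (intro order_trans[OF norm_le_l1_cart] sum_mono)
    then show ?thesis
      unfolding norm_vec_def[of Q] by (intro order_trans[OF L2_set_le_sum] sum_mono) auto
  qed
  then show "bounded {Q :: real ^ 'r ^ 'i. transpose Q ** Q = mat 1}"
    by (intro boundedI) blast
  show "closed {Q :: real ^ 'r ^ 'i. transpose Q ** Q = mat 1}"
    by (intro closed_Collect_eq continuous_intros)
qed

text \<open>
  Replacing the triangular factors by \<open>Q\<^sub>a\<^sup>T Y\<^sub>k Q\<^sub>b\<close> eliminates the unbounded witnesses: what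
  remains is a closed condition on \<open>Y\<close> and a pair \<open>(Q\<^sub>a, Q\<^sub>b)\<close> from a compact set, and projecting
  along a compact set preserves closedness.
\<close>

lemma closed_full_GSD_arrays:
  "closed (full_GSD_arrays TYPE('r :: {finite, linorder}) :: (real ^ 2 ^ 'j ^ 'i) set)"
proof -
  let ?K = "{Q :: real ^ 'r::_ ^ 'i. transpose Q ** Q = mat 1} \<times> {Q :: real ^ 'r::_ ^ 'j. transpose Q ** Q = mat 1}"
  let ?M = "\<lambda>(z :: ((real ^ 'r::_ ^ 'i) \<times> (real ^ 'r::_ ^ 'j)) \<times> (real ^ 2 ^ 'j ^ 'i)) k.
    transpose (fst (fst z)) ** frontal_slice k (snd z) ** snd (fst z)"
  let ?C = "{z. \<forall>k. (\<forall>p q. q < p \<longrightarrow> ?M z k $ p $ q = 0) \<and>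
    frontal_slice k (snd z) = fst (fst z) ** ?M z k ** transpose (snd (fst z))}"
  have "closed ?C"
    by (intro closed_Collect_all closed_Collect_conj closed_Collect_imp open_Collect_const
        closed_Collect_eq continuous_intros)
  moreover have "compact ?K"
    by (intro compact_Times compact_orthonormal_columns)
  ultimately have "closed {Y. \<exists>Q. Q \<in> ?K \<and> (Q, Y) \<in> ?C}"
    by (intro closed_compact_projection)
  also have "{Y. \<exists>Q. Q \<in> ?K \<and> (Q, Y) \<in> ?C} = full_GSD_arrays TYPE('r)"
  proof (intro set_eqI iffI)
    fix Y assume "Y \<in> {Y. \<exists>Q. Q \<in> ?K \<and> (Q, Y) \<in> ?C}"
    then obtain Qa Qb where "(Qa, Qb) \<in> ?K" "((Qa, Qb), Y) \<in> ?C"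
      by auto
    then show "Y \<in> full_GSD_arrays TYPE('r)"
      unfolding full_GSD_arrays_def upper_triangular_def
      by (intro CollectI exI[of _ Qa] exI[of _ Qb] exI[of _ "?M ((Qa, Qb), Y)"]) auto
  next
    fix Y :: "real ^ 2 ^ 'j ^ 'i" assume "Y \<in> full_GSD_arrays TYPE('r)"
    then obtain Qa :: "real ^ 'r::_ ^ 'i" and Qb :: "real ^ 'r::_ ^ 'j" and T :: "2 \<Rightarrow> real ^ 'r::_ ^ 'r::_"
      where Q: "transpose Qa ** Qa = mat 1" "transpose Qb ** Qb = mat 1"
        and T: "\<And>k. upper_triangular (T k)"
        and Y: "\<And>k. frontal_slice k Y = Qa ** T k ** transpose Qb"
      by (auto simp: full_GSD_arrays_def)
    have "transpose Qa ** frontal_slice k Y ** Qb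
        = (transpose Qa ** Qa) ** T k ** (transpose Qb ** Qb)" for k
      unfolding Y by (simp add: matrix_mul_assoc)
    then have "transpose Qa ** frontal_slice k Y ** Qb = T k" for k
      by (simp add: Q)
    then have "((Qa, Qb), Y) \<in> ?C"
      using T Y by (simp add: upper_triangular_def)
    then show "Y \<in> {Y. \<exists>Q. Q \<in> ?K \<and> (Q, Y) \<in> ?C}"
      using Q by auto
  qed
  finally show ?thesis .
qed

section \<open>The closure of the arrays of bounded rank\<close>

theorem theorem3p2:
  assumes "CARD('r :: {finite, linorder}) \<le> min CARD('i :: finite) CARD('j :: finite)"
  shows "(full_GSD_arrays TYPE('r) :: (real ^ 2 ^ 'j ^ 'i) set) =
    closure (rank_le_arrays CARD('r))"
proof
  show "(full_GSD_arrays TYPE('r) :: (real ^ 2 ^ 'j ^ 'i) set) \<subseteq> closure (rank_le_arrays CARD('r))"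
    by (rule full_GSD_arrays_subset_closure)
  show "closure (rank_le_arrays CARD('r)) \<subseteq> (full_GSD_arrays TYPE('r) :: (real ^ 2 ^ 'j ^ 'i) set)"
    by (rule closure_minimal[OF rank_le_arrays_subset_full_GSD_arrays[OF assms] closed_full_GSD_arrays])
qed

end
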